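(* Let $G$ be a connected graph with $n$ vertices and let $e$ be an edge of the complement of $G$ (i.e. a pair of distinct nonadjacent vertices of $G$). Then $B(G+e)<B(G)$, where $G+e$ is the graph obtained from $G$ by adding the edge $e$.
   Context: All graphs are finite, simple and undirected. The Laplacian matrix of $G$ is $L=D-A$ ($A$ adjacency matrix, $D$ diagonal degree matrix). $L^{+}$ is the Moore–Penrose inverse of $L$ and $L^{2+}=(L^{+})^2$. The biharmonic distance is the nonnegative number $d_B(u,v)$ with $d_B^2(u,v)=L^{2+}_{uu}+L^{2+}_{vv}-2L^{2+}_{uv}$, and the biharmonic index is $B(G)=\frac12\sum_{u\in V(G)}\sum_{v\in V(G)}d_B^2(u,v)$. *)

theory Defs
  imports "HOL-Analysis.Analysis" "Graph_Theory.Graph_Theory"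
begin

text \<open>
  A finite simple undirected graph is a \<^locale>\<open>pair_graph\<close>: a finite, loopfree, symmetric digraph
  without parallel arcs, so that an undirected edge \<open>{u, v}\<close> is the pair of arcs \<open>(u, v)\<close>, \<open>(v, u)\<close>.
  The matrices below have the vertex type as index type and are meant for graphs whose vertex
  set is all of that type.
\<close>

definition add_edge :: "'v pair_pre_digraph \<Rightarrow> 'v \<Rightarrow> 'v \<Rightarrow> 'v pair_pre_digraph" where
  "add_edge G u v = G\<lparr>parcs := parcs G \<union> {(u, v), (v, u)}\<rparr>"

definition adjacency_matrix :: "'v::finite pair_pre_digraph \<Rightarrow> real ^ 'v ^ 'v" where
  "adjacency_matrix G = (\<chi> u v. if (u, v) \<in> parcs G then 1 else 0)"

text \<open>In a symmetric digraph the out-degree is the number of neighbours.\<close>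

definition degree_matrix :: "'v::finite pair_pre_digraph \<Rightarrow> real ^ 'v ^ 'v" where
  "degree_matrix G = (\<chi> u v. if u = v then real (out_degree (with_proj G) u) else 0)"

definition laplacian_matrix :: "'v::finite pair_pre_digraph \<Rightarrow> real ^ 'v ^ 'v" where
  "laplacian_matrix G = degree_matrix G - adjacency_matrix G"

definition is_moore_penrose_inverse :: "real ^ 'n ^ 'm \<Rightarrow> real ^ 'm ^ 'n \<Rightarrow> bool" where
  "is_moore_penrose_inverse A X \<longleftrightarrow>
     A ** X ** A = A \<and> X ** A ** X = X \<and>
     transpose (A ** X) = A ** X \<and> transpose (X ** A) = X ** A"

lemma is_moore_penrose_inverse_unique:
  fixes A :: "real ^ 'n ^ 'm"
  assumes "is_moore_penrose_inverse A X" "is_moore_penrose_inverse A Y"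
  shows "X = Y"
proof -
  note X = assms(1)[unfolded is_moore_penrose_inverse_def]
  note Y = assms(2)[unfolded is_moore_penrose_inverse_def]
  have AX: "A ** X = A ** Y"
  proof -
    have "A ** X = (A ** Y) ** (A ** X)" using Y by (simp add: matrix_mul_assoc)
    also have "\<dots> = transpose ((A ** X) ** (A ** Y))" using X Y by (simp add: matrix_transpose_mul)
    also have "(A ** X) ** (A ** Y) = A ** Y" using X by (simp add: matrix_mul_assoc)
    finally show ?thesis using Y by simp
  qed
  have XA: "X ** A = Y ** A"
  proof -
    have "X ** A = (X ** A) ** (Y ** A)" using Y by (metis matrix_mul_assoc)
    also have "\<dots> = transpose ((Y ** A) ** (X ** A))" using X Y by (simp add: matrix_transpose_mul)
    also have "(Y ** A) ** (X ** A) = Y ** A" using X by (metis matrix_mul_assoc)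
    finally show ?thesis using Y by simp
  qed
  have "X = X ** A ** X" using X by simp
  also have "\<dots> = Y ** (A ** X)" using XA by (simp add: matrix_mul_assoc)
  also have "\<dots> = Y" using AX Y by (simp add: matrix_mul_assoc)
  finally show ?thesis .
qed

definition moore_penrose_inverse :: "real ^ 'n ^ 'm \<Rightarrow> real ^ 'm ^ 'n" where
  "moore_penrose_inverse A = (THE X. is_moore_penrose_inverse A X)"

definition laplacian_pinv_squared :: "'v::finite pair_pre_digraph \<Rightarrow> real ^ 'v ^ 'v" where
  "laplacian_pinv_squared G =
     moore_penrose_inverse (laplacian_matrix G) ** moore_penrose_inverse (laplacian_matrix G)"

definition biharmonic_distance :: "'v::finite pair_pre_digraph \<Rightarrow> 'v \<Rightarrow> 'v \<Rightarrow> real" where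
  "biharmonic_distance G u v =
     sqrt (laplacian_pinv_squared G $ u $ u + laplacian_pinv_squared G $ v $ v
           - 2 * laplacian_pinv_squared G $ u $ v)"

definition biharmonic_index :: "'v::finite pair_pre_digraph \<Rightarrow> real" where
  "biharmonic_index G =
     1 / 2 * (\<Sum>u\<in>pverts G. \<Sum>v\<in>pverts G. (biharmonic_distance G u v)\<^sup>2)"

end

theory Submission
  imports Defs
begin

text \<open>Let \<open>L\<close> be the Laplacian matrix of \<open>G\<close> and \<open>X\<close> its pseudoinverse. As \<open>X\<close> annihilates the constant
  vectors, \<open>B(G) = n tr(X\<^sup>2)\<close>. Adding an edge changes \<open>L\<close> into \<open>L + w w\<^sup>T\<close> with \<open>w = e\<^sub>u - e\<^sub>v\<close> in the range
  of \<open>L\<close>, so the Sherman-Morrison formula holds for the pseudoinverse: with \<open>y = X w\<close> and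
  \<open>c = w\<^sup>T X w\<close> the new one is \<open>X - y y\<^sup>T / (1 + c)\<close>. Hence the trace of the square decreases by
  \<open>2 y\<^sup>T X y / (1 + c) - |y|\<^sup>4 / (1 + c)\<^sup>2\<close>, which is positive because \<open>|y|\<^sup>4 = (y\<^sup>T X w)\<^sup>2 \<le> c y\<^sup>T X y\<close> by
  Cauchy-Schwarz for the positive semidefinite form \<open>X\<close>.\<close>

section \<open>Matrix algebra and outer products\<close>

lemma matrix_diff_ldistrib:
  fixes A :: "'a::ring_1 ^ 'n ^ 'm"
  shows "A ** (B - C) = A ** B - A ** C"
  by (simp add: vec_eq_iff matrix_matrix_mult_def right_diff_distrib sum_subtractf)

lemma matrix_diff_rdistrib:
  fixes A :: "'a::ring_1 ^ 'n ^ 'm"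
  shows "(A - B) ** C = A ** C - B ** C"
  by (simp add: vec_eq_iff matrix_matrix_mult_def left_diff_distrib sum_subtractf)

lemma matrix_add_rdistrib:
  fixes A :: "'a::semiring_1 ^ 'n ^ 'm"
  shows "(A + B) ** C = A ** C + B ** C"
  by (simp add: vec_eq_iff matrix_matrix_mult_def distrib_right sum.distrib)

lemma matrix_mult_scaleR_left: "(k *\<^sub>R A) ** B = k *\<^sub>R (A ** B)" for A :: "real ^ 'n ^ 'm"
  by (simp add: scalar_matrix_assoc)

lemma matrix_mult_scaleR_right: "A ** (k *\<^sub>R B) = k *\<^sub>R (A ** B)" for A :: "real ^ 'n ^ 'm"
  by (simp add: matrix_scalar_ac scalar_matrix_assoc)

lemma transpose_add: "transpose (A + B) = transpose A + transpose B"
  by (simp add: vec_eq_iff transpose_def)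

lemma transpose_diff: "transpose (A - B) = transpose A - transpose B"
  by (simp add: vec_eq_iff transpose_def)

lemma inner_matrix_vector_mult_symmetric:
  fixes A :: "real ^ 'n ^ 'n"
  assumes "transpose A = A"
  shows "(A *v x) \<bullet> y = x \<bullet> (A *v y)"
  by (metis assms dot_lmul_matrix vector_transpose_matrix)

definition outer_product :: "real ^ 'm \<Rightarrow> real ^ 'n \<Rightarrow> real ^ 'n ^ 'm" where
  "outer_product x y = (\<chi> i j. x $ i * y $ j)"

lemma matrix_mult_outer_product: "A ** outer_product x y = outer_product (A *v x) y"
  by (simp add: vec_eq_iff outer_product_def matrix_matrix_mult_def matrix_vector_mult_def
      sum_distrib_right mult.assoc)

lemma outer_product_mult_matrix: "outer_product x y ** A = outer_product x (transpose A *v y)"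
  by (simp add: vec_eq_iff outer_product_def matrix_matrix_mult_def matrix_vector_mult_def
      transpose_def sum_distrib_left mult_ac)

lemma outer_product_mult_vector: "outer_product x y *v z = (y \<bullet> z) *\<^sub>R x"
  by (simp add: vec_eq_iff outer_product_def matrix_vector_mult_def inner_vec_def
      sum_distrib_left mult_ac)

lemma outer_product_scaleR_left: "outer_product (a *\<^sub>R x) y = a *\<^sub>R outer_product x y"
  by (simp add: vec_eq_iff outer_product_def)

lemma outer_product_add_left: "outer_product (x + x') y = outer_product x y + outer_product x' y"
  by (simp add: vec_eq_iff outer_product_def distrib_right)

lemma outer_product_diff_left: "outer_product (x - x') y = outer_product x y - outer_product x' y"
  by (simp add: vec_eq_iff outer_product_def left_diff_distrib)

lemma transpose_outer_product: "transpose (outer_product x y) = outer_product y x"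
  by (simp add: vec_eq_iff outer_product_def transpose_def mult.commute)

lemma trace_outer_product: "trace (outer_product x y) = x \<bullet> y"
  by (simp add: trace_def outer_product_def inner_vec_def)

lemma trace_scaleR: "trace (a *\<^sub>R A) = a * trace A" for A :: "real ^ 'n ^ 'n"
  by (simp add: trace_def sum_distrib_left)

lemmas outer_product_simps = matrix_mult_outer_product outer_product_mult_matrix
  outer_product_mult_vector outer_product_add_left outer_product_diff_left outer_product_scaleR_left
  transpose_outer_product scaleR_matrix_vector_assoc[symmetric]

section \<open>Pseudoinverses of symmetric and positive semidefinite matrices\<close>

lemma moore_penrose_inverse_eqI:
  "is_moore_penrose_inverse A X \<Longrightarrow> moore_penrose_inverse A = X"
  unfolding moore_penrose_inverse_def
  by (blast intro: the_equality is_moore_penrose_inverse_unique)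

lemma is_moore_penrose_inverse_transpose:
  assumes "is_moore_penrose_inverse A X"
  shows "is_moore_penrose_inverse (transpose A) (transpose X)"
proof -
  note mp = assms[unfolded is_moore_penrose_inverse_def]
  have "transpose (A ** X ** A) = transpose A" "transpose (X ** A ** X) = transpose X"
    "transpose (A ** X) = A ** X" "transpose (X ** A) = X ** A"
    using mp by auto
  then show ?thesis
    by (simp add: is_moore_penrose_inverse_def matrix_transpose_mul matrix_mul_assoc)
qed

text \<open>Transposing the defining equations makes \<open>transpose X\<close> a pseudoinverse of
  \<open>transpose A = A\<close>, so uniqueness gives symmetry. Commutation then follows from the
  symmetry of \<open>A ** X\<close>.\<close>

lemma symmetric_moore_penrose_inverse:
  assumes "is_moore_penrose_inverse A X" "transpose A = A"
  shows "transpose X = X" "X ** A = A ** X"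
proof -
  show X: "transpose X = X"
    by (rule is_moore_penrose_inverse_unique[OF _ assms(1)])
      (use is_moore_penrose_inverse_transpose[OF assms(1)] in \<open>simp only: assms(2)\<close>)
  have "X ** A = transpose (A ** X)"
    by (simp add: matrix_transpose_mul X assms(2))
  then show "X ** A = A ** X"
    using assms(1) by (simp add: is_moore_penrose_inverse_def)
qed

definition positive_semidefinite :: "real ^ 'n ^ 'n \<Rightarrow> bool" where
  "positive_semidefinite A \<longleftrightarrow> transpose A = A \<and> (\<forall>x. 0 \<le> x \<bullet> (A *v x))"

text \<open>Writing \<open>X = X ** A ** X\<close> turns the form of \<open>X\<close> at
  \<open>x\<close> into the form of \<open>A\<close> at \<open>X *v x\<close>.\<close>

lemma positive_semidefinite_moore_penrose_inverse:
  assumes "is_moore_penrose_inverse A X" "positive_semidefinite A"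
  shows "positive_semidefinite X"
proof -
  have sym: "transpose X = X"
    using symmetric_moore_penrose_inverse assms by (auto simp: positive_semidefinite_def)
  have "x \<bullet> (X *v x) = (X *v x) \<bullet> (A *v (X *v x))" for x
  proof -
    have "x \<bullet> (X *v x) = x \<bullet> (X *v (A *v (X *v x)))"
      using assms(1) by (simp add: is_moore_penrose_inverse_def matrix_vector_mul_assoc matrix_mul_assoc)
    then show ?thesis
      by (simp add: inner_matrix_vector_mult_symmetric[OF sym])
  qed
  then show ?thesis
    using assms(2) sym by (simp add: positive_semidefinite_def)
qed

text \<open>The form is nonnegative on every combination of \<open>x\<close> and \<open>y\<close>,
  and suitable coefficients give the bound. As the form may be degenerate, the case
  \<open>a = 0\<close> is treated separately.\<close>

lemma positive_semidefinite_Cauchy_Schwarz: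
  assumes "positive_semidefinite A"
  shows "(x \<bullet> (A *v y))\<^sup>2 \<le> (x \<bullet> (A *v x)) * (y \<bullet> (A *v y))"
proof -
  have sym: "transpose A = A" and nn: "\<And>x. 0 \<le> x \<bullet> (A *v x)"
    using assms by (auto simp: positive_semidefinite_def)
  define a b c where "a = x \<bullet> (A *v x)" and "b = x \<bullet> (A *v y)" and "c = y \<bullet> (A *v y)"
  have yx: "y \<bullet> (A *v x) = b"
    unfolding b_def by (metis inner_commute inner_matrix_vector_mult_symmetric[OF sym])
  have quad: "0 \<le> s\<^sup>2 * a - 2 * s * t * b + t\<^sup>2 * c" for s t
  proof -
    have "(s *\<^sub>R x - t *\<^sub>R y) \<bullet> (A *v (s *\<^sub>R x - t *\<^sub>R y)) = s\<^sup>2 * a - 2 * s * t * b + t\<^sup>2 * c"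
      by (simp add: matrix_vector_mult_diff_distrib matrix_vector_mult_scaleR inner_diff_left
          inner_diff_right yx a_def[symmetric] b_def[symmetric] c_def[symmetric] power2_eq_square
          algebra_simps)
    then show ?thesis using nn by metis
  qed
  have "b\<^sup>2 \<le> a * c"
  proof (cases "a = 0")
    case True
    \<comment> \<open>If \<open>b\<close> were nonzero, this choice of \<open>s\<close> would make
      the form equal to \<open>c - (c + 1) = -1\<close>.\<close>
    have "b = 0"
      using quad[of "(c + 1) / (2 * b)" 1] True by (cases "b = 0") auto
    then show ?thesis using True by simp
  next
    case False
    then have "0 < a" using nn[of x] by (simp add: a_def)
    have "0 \<le> a * (a * c - b\<^sup>2)"
      using quad[of b a] by (simp add: power2_eq_square algebra_simps)
    then show ?thesis using \<open>0 < a\<close> by (simp add: zero_le_mult_iff)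
  qed
  then show ?thesis by (simp add: a_def b_def c_def)
qed

section \<open>Rank-one updates of a pseudoinverse\<close>

text \<open>\<open>A ** X\<close> is the orthogonal projection onto the range of \<open>A\<close>,
  which contains \<open>w\<close> by hypothesis. The update keeps this range, so both products of
  the new pair are again \<open>A ** X\<close>, and it remains to see that this projection fixes
  both new matrices.\<close>

lemma is_moore_penrose_inverse_rank_one_update:
  assumes X: "is_moore_penrose_inverse A X" and A: "positive_semidefinite A"
    and w: "A *v (X *v w) = w"
  defines "y \<equiv> X *v w" and "k \<equiv> 1 / (1 + w \<bullet> (X *v w))"
  shows "is_moore_penrose_inverse (A + outer_product w w) (X - k *\<^sub>R outer_product y y)"
    (is "is_moore_penrose_inverse ?A ?X")
proof -
  note mp = X[unfolded is_moore_penrose_inverse_def]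
  have symA: "transpose A = A" using A by (simp add: positive_semidefinite_def)
  note symX = symmetric_moore_penrose_inverse(1)[OF X symA]
    and comm = symmetric_moore_penrose_inverse(2)[OF X symA]
  have "0 \<le> w \<bullet> y"
    using positive_semidefinite_moore_penrose_inverse[OF X A]
    by (simp add: positive_semidefinite_def y_def)
  \<comment> \<open>Nonnegativity of \<open>w \<bullet> y\<close> keeps the denominator of
    \<open>k\<close> away from 0. This identity cancels the rank-one terms in
    \<open>?A ** ?X\<close>.\<close>
  then have k: "k + k * (w \<bullet> y) = 1"
    by (simp add: k_def y_def[symmetric] field_simps)
  have Ay: "A *v y = w" using w by (simp add: y_def)
  have symA': "transpose ?A = ?A" and symX': "transpose ?X = ?X"
    by (simp_all add: transpose_add transpose_diff transpose_scalar symA symX outer_product_simps)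
  have "?A ** ?X = A ** X + outer_product w y
      - k *\<^sub>R outer_product w y - (k * (w \<bullet> y)) *\<^sub>R outer_product w y"
    by (simp add: matrix_diff_ldistrib matrix_add_rdistrib matrix_mult_scaleR_right matrix_mult_scaleR_left
        outer_product_simps Ay symX y_def[symmetric] algebra_simps)
  also have "\<dots> = A ** X + (1 - (k + k * (w \<bullet> y))) *\<^sub>R outer_product w y"
    by (simp add: algebra_simps)
  finally have AX: "?A ** ?X = A ** X" by (simp add: k)
  have "?X ** ?A = transpose (?A ** ?X)"
    by (simp only: matrix_transpose_mul symA' symX')
  then have XA: "?X ** ?A = A ** X" using AX mp by simp
  have "A ** X ** ?A = ?A"
    using mp w by (simp add: matrix_add_ldistrib outer_product_simps matrix_vector_mul_assoc[symmetric])
  moreover have "A ** X ** ?X = ?X"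
  proof -
    have "A ** X ** X = X" by (simp add: comm[symmetric] mp)
    moreover have "A ** X *v y = y"
      by (metis matrix_vector_mul_assoc comm Ay y_def)
    ultimately show ?thesis
      by (simp add: matrix_diff_ldistrib matrix_mult_scaleR_right outer_product_simps)
  qed
  ultimately show ?thesis
    unfolding is_moore_penrose_inverse_def using AX XA mp by metis
qed

lemma trace_square_moore_penrose_inverse_rank_one_update:
  assumes X: "is_moore_penrose_inverse A X" and A: "positive_semidefinite A"
    and w: "A *v (X *v w) = w" "w \<noteq> 0"
    and X': "is_moore_penrose_inverse (A + outer_product w w) X'"
  shows "trace (X' ** X') < trace (X ** X)"
proof -
  define y where "y = X *v w"
  define c where "c = w \<bullet> (X *v w)"
  define q where "q = y \<bullet> (X *v y)"
  define s where "s = y \<bullet> y"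
  define k where "k = 1 / (1 + c)"
  have X'_eq: "X' = X - k *\<^sub>R outer_product y y"
    using is_moore_penrose_inverse_rank_one_update[OF X A w(1)] X'
    unfolding y_def k_def c_def by (rule is_moore_penrose_inverse_unique[rotated])
  have psd: "positive_semidefinite X"
    by (rule positive_semidefinite_moore_penrose_inverse[OF X A])
  then have symX: "transpose X = X" and c: "0 \<le> c"
    by (simp_all add: positive_semidefinite_def c_def)
  \<comment> \<open>If \<open>X *v w\<close> were 0, then \<open>w = A *v (X *v w)\<close> would be
    0 as well.\<close>
  have "y \<noteq> 0" using w by (auto simp: y_def)
  then have s: "0 < s" by (simp add: s_def)
  \<comment> \<open>Here \<open>s\<close> is read as \<open>y \<bullet> (X *v w)\<close>, a mixed
    value of the form \<open>X\<close>.\<close>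
  have "s\<^sup>2 \<le> q * c"
    using positive_semidefinite_Cauchy_Schwarz[OF psd, of y w]
    by (simp add: s_def q_def c_def y_def)
  then have q: "0 < q" "s\<^sup>2 \<le> q * c"
    using s c by (smt (verit) zero_less_power mult_nonpos_nonneg)+
  have kc: "0 < k" "k * c < 1" using c by (simp_all add: k_def)
  have "k * s\<^sup>2 \<le> k * c * q"
    using q kc by (simp add: mult.assoc mult.commute)
  also have "\<dots> < 1 * q" by (rule mult_strict_right_mono) (use q kc in auto)
  also have "\<dots> \<le> 2 * q" using q by simp
  finally have "k * (k * s\<^sup>2) < k * (2 * q)" using kc by simp
  \<comment> \<open>Each of the two cross terms has trace \<open>q\<close>, and the square of
    \<open>outer_product y y\<close> has trace \<open>s\<^sup>2\<close>.\<close>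
  moreover have "trace (X' ** X') = trace (X ** X) - k * (2 * q) + k * (k * s\<^sup>2)"
    unfolding X'_eq
    by (simp add: matrix_diff_ldistrib matrix_diff_rdistrib matrix_mult_scaleR_right
        matrix_mult_scaleR_left outer_product_simps symX trace_add trace_sub trace_scaleR
        matrix_vector_mult_diff_rdistrib
        trace_outer_product inner_commute s_def q_def power2_eq_square algebra_simps)
  ultimately show ?thesis by simp
qed

section \<open>The Laplacian, its pseudoinverse and the biharmonic index\<close>

text \<open>Spreading the degree term over the neighbours turns a row into a sum of differences.
  This form yields the kernel vector 1, the quadratic form and the effect of a new edge.\<close>

lemma laplacian_mult_vector:
  fixes G :: "'v::finite pair_pre_digraph"
  shows "(laplacian_matrix G *v x) $ i = (\<Sum>j\<in>UNIV. if (i, j) \<in> parcs G then x $ i - x $ j else 0)"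
proof -
  have "out_arcs (with_proj G) i = Pair i ` {j. (i, j) \<in> parcs G}"
    by (auto simp: out_arcs_def)
  then have "out_degree (with_proj G) i = card {j. (i, j) \<in> parcs G}"
    by (simp add: out_degree_def card_image inj_on_def)
  then have deg: "real (out_degree (with_proj G) i) = (\<Sum>j\<in>UNIV. if (i, j) \<in> parcs G then 1 else 0)"
    by (simp flip: sum.inter_filter)
  have "(laplacian_matrix G *v x) $ i =
      (\<Sum>j\<in>UNIV. (if i = j then real (out_degree (with_proj G) i) * x $ j else 0))
      - (\<Sum>j\<in>UNIV. if (i, j) \<in> parcs G then x $ j else 0)"
    by (simp add: laplacian_matrix_def degree_matrix_def adjacency_matrix_def matrix_vector_mult_def
        left_diff_distrib sum_subtractf if_distrib[of "\<lambda>a. a * _"] cong: if_cong)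
  also have "\<dots> = (\<Sum>j\<in>UNIV. if (i, j) \<in> parcs G then x $ i - x $ j else 0)"
    by (simp add: deg sum_distrib_right sum_subtractf[symmetric] if_distrib[of "\<lambda>a. a * _"] cong: if_cong)
      (rule sum.cong; simp)
  finally show ?thesis .
qed

lemma laplacian_mult_one: "laplacian_matrix G *v 1 = 0"
  by (simp add: vec_eq_iff laplacian_mult_vector cong: if_cong)

lemma transpose_laplacian:
  assumes "sym (parcs G)"
  shows "transpose (laplacian_matrix G) = laplacian_matrix G"
  using symD[OF assms]
  by (auto simp: vec_eq_iff transpose_def laplacian_matrix_def degree_matrix_def adjacency_matrix_def)

text \<open>Exchanging \<open>i\<close> and \<open>j\<close> leaves the double sum unchanged, and
  adding the two versions completes the square on every arc.\<close>

lemma laplacian_quadratic_form: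
  assumes "sym (parcs G)"
  shows "x \<bullet> (laplacian_matrix G *v x) =
    1 / 2 * (\<Sum>i\<in>UNIV. \<Sum>j\<in>UNIV. if (i, j) \<in> parcs G then (x $ i - x $ j)\<^sup>2 else 0)"
proof -
  let ?f = "\<lambda>i j. if (i, j) \<in> parcs G then x $ i * (x $ i - x $ j) else 0"
  have "x \<bullet> (laplacian_matrix G *v x) = (\<Sum>i\<in>UNIV. \<Sum>j\<in>UNIV. ?f i j)"
    by (simp add: inner_vec_def laplacian_mult_vector sum_distrib_left if_distrib[of "\<lambda>a. _ * a"] cong: if_cong)
  moreover have "(\<Sum>i\<in>UNIV. \<Sum>j\<in>UNIV. ?f i j) = (\<Sum>i\<in>UNIV. \<Sum>j\<in>UNIV. ?f j i)"
    by (rule sum.swap)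
  moreover have "(\<Sum>i\<in>UNIV. \<Sum>j\<in>UNIV. ?f i j) + (\<Sum>i\<in>UNIV. \<Sum>j\<in>UNIV. ?f j i) =
      (\<Sum>i\<in>UNIV. \<Sum>j\<in>UNIV. if (i, j) \<in> parcs G then (x $ i - x $ j)\<^sup>2 else 0)"
    unfolding sum.distrib[symmetric] using symD[OF assms]
    by (intro sum.cong refl) (auto simp: power2_eq_square algebra_simps)
  ultimately show ?thesis by simp
qed

lemma positive_semidefinite_laplacian:
  assumes "sym (parcs G)"
  shows "positive_semidefinite (laplacian_matrix G)"
  unfolding positive_semidefinite_def laplacian_quadratic_form[OF assms]
  by (auto simp: transpose_laplacian[OF assms] intro!: sum_nonneg)

lemma laplacian_quadratic_form_eq_0D:
  assumes "sym (parcs G)" "x \<bullet> (laplacian_matrix G *v x) = 0" "(i, j) \<in> parcs G"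
  shows "x $ i = x $ j"
proof -
  have "(\<Sum>i\<in>UNIV. \<Sum>j\<in>UNIV. if (i, j) \<in> parcs G then (x $ i - x $ j)\<^sup>2 else 0) = 0"
    using assms(2) laplacian_quadratic_form[OF assms(1)] by simp
  then have "(if (i, j) \<in> parcs G then (x $ i - x $ j)\<^sup>2 else 0) = 0"
    by (subst (asm) sum_nonneg_eq_0_iff; simp add: sum_nonneg_eq_0_iff sum_nonneg)
  then show ?thesis using assms(3) by simp
qed

text \<open>Connectedness means that the symmetric closure is strongly connected; \<open>f\<close>
  is preserved along each arc of the closure, hence along walks.\<close>

lemma constant_if_connected:
  fixes f :: "'v \<Rightarrow> 'a"
  assumes "pverts G = UNIV" "Digraph_Component.connected (with_proj G)"
    and "\<And>i j. (i, j) \<in> parcs G \<Longrightarrow> f i = f j"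
  shows "f i = f j"
proof -
  have "i \<rightarrow>\<^sup>*\<^bsub>with_proj (mk_symmetric (with_proj G))\<^esub> j"
    using assms(1,2) by (auto simp: connected_def strongly_connected_def)
  then show ?thesis unfolding reachable_def
    by (induction rule: rtrancl_on_induct)
      (use assms(3) in \<open>auto simp: parcs_mk_symmetric\<close>)
qed

text \<open>Since the kernel of \<open>L\<close> consists of the constant vectors, \<open>L + J / n\<close> is invertible (\<open>J\<close> the
  all-ones matrix), and \<open>(L + J / n)\<^sup>-\<^sup>1 - J / n\<close> is the pseudoinverse of \<open>L\<close>.\<close>

lemma laplacian_moore_penrose_inverse_exists:
  fixes G :: "'v::finite pair_pre_digraph"
  assumes sym: "sym (parcs G)" and "pverts G = UNIV" "Digraph_Component.connected (with_proj G)"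
  obtains X where "is_moore_penrose_inverse (laplacian_matrix G) X"
    "laplacian_matrix G ** X = mat 1 - (1 / real CARD('v)) *\<^sub>R outer_product 1 1"
proof -
  define L where "L = laplacian_matrix G"
  define K :: "real ^ 'v ^ 'v" where "K = (1 / real CARD('v)) *\<^sub>R outer_product 1 1"
  define M where "M = L + K"
  have L1: "L *v 1 = 0" by (simp add: L_def laplacian_mult_one)
  have symL: "transpose L = L" by (simp add: L_def transpose_laplacian[OF sym])
  have symK: "transpose K = K" by (simp add: K_def transpose_scalar outer_product_simps)
  have nL: "0 \<le> x \<bullet> (L *v x)" for x
    using positive_semidefinite_laplacian[OF sym] by (simp add: L_def positive_semidefinite_def)
  have Kx: "K *v x = ((1 \<bullet> x) / real CARD('v)) *\<^sub>R 1" for x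
    by (simp add: K_def outer_product_simps)
  have one: "(1 :: real ^ 'v) \<bullet> 1 = real CARD('v)" by (simp add: inner_vec_def)
  have "x = 0" if "M *v x = 0" for x
  proof -
    \<comment> \<open>The form of \<open>M\<close> splits into two nonnegative terms, so both
      vanish: the first makes \<open>x\<close> constant, the second makes its entries sum to
      0.\<close>
    have "0 = x \<bullet> (M *v x)" using that by simp
    also have "\<dots> = x \<bullet> (L *v x) + (1 \<bullet> x)\<^sup>2 / real CARD('v)"
      by (simp add: M_def matrix_vector_mult_add_rdistrib inner_add_right Kx inner_commute power2_eq_square)
    finally have "x \<bullet> (L *v x) + (1 \<bullet> x)\<^sup>2 / real CARD('v) = 0" by simp
    moreover have "0 \<le> (1 \<bullet> x)\<^sup>2 / real CARD('v)" by simp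
    ultimately have "x \<bullet> (L *v x) = 0" and "(1 \<bullet> x)\<^sup>2 / real CARD('v) = 0"
      using nL[of x] by linarith+
    then have "x \<bullet> (L *v x) = 0" and sum: "1 \<bullet> x = 0" by simp_all
    then have "x $ i = x $ j" for i j
      using constant_if_connected[OF assms(2,3), of "($) x"] laplacian_quadratic_form_eq_0D[OF sym]
      unfolding L_def by blast
    then have "x = (x $ i) *\<^sub>R 1" for i by (simp add: vec_eq_iff)
    then show "x = 0" using sum one
      by (metis inner_scaleR_right mult_eq_0_iff of_nat_eq_0_iff zero_less_card_finite less_irrefl
          scale_eq_0_iff)
  qed
  then obtain N where NM: "N ** M = mat 1"
    using matrix_left_invertible_ker by blast
  then have MN: "M ** N = mat 1" by (simp add: matrix_left_right_inverse)
  have M1: "M *v 1 = 1" using one by (simp add: M_def matrix_vector_mult_add_rdistrib L1 Kx)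
  have symM: "transpose M = M" by (simp add: M_def transpose_add symL symK)
  have "N *v 1 = 1" by (metis M1 NM matrix_vector_mul_assoc matrix_vector_mul_lid)
  then have NK: "N ** K = K"
    by (simp add: K_def matrix_mult_scaleR_right outer_product_simps)
  have symN: "transpose N = N"
  proof -
    have "transpose N ** M = transpose (M ** N)" by (simp add: matrix_transpose_mul symM)
    then have "transpose N ** M ** N = N" by (simp add: MN)
    then show ?thesis by (simp add: MN flip: matrix_mul_assoc)
  qed
  have KN: "K ** N = K" by (metis NK matrix_transpose_mul symK symN)
  have KK: "K ** K = K"
    using one by (simp add: K_def matrix_mult_scaleR_right matrix_mult_scaleR_left outer_product_simps)
  have LK: "L ** K = 0"
    by (simp add: K_def matrix_mult_scaleR_right outer_product_simps L1) (simp add: outer_product_def vec_eq_iff)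
  have KL: "K ** L = 0"
    by (metis LK matrix_transpose_mul symK symL transpose_iff transpose_mat mat_0)
  define X where "X = N - K"
  \<comment> \<open>In \<open>(M - K) ** (N - K)\<close> the products \<open>M ** K\<close>,
    \<open>K ** N\<close> and \<open>K ** K\<close> all equal \<open>K\<close>, which leaves
    \<open>mat 1 - K\<close>.\<close>
  have "L ** X = (M - K) ** X" by (simp add: M_def)
  then have LX: "L ** X = mat 1 - K"
    by (simp add: X_def M_def[symmetric] matrix_diff_ldistrib matrix_diff_rdistrib MN KN NK KK)
      (metis KK M_def LK add_0 matrix_add_rdistrib)
  have symX: "transpose X = X" by (simp add: X_def transpose_diff symN symK)
  have "X ** L = transpose (L ** X)" by (simp add: matrix_transpose_mul symL symX)
  then have XL: "X ** L = mat 1 - K" by (simp add: LX transpose_diff symK)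
  have "K ** X = 0" by (simp add: X_def matrix_diff_ldistrib KN KK)
  then have "is_moore_penrose_inverse L X"
    by (simp add: is_moore_penrose_inverse_def LX XL matrix_diff_rdistrib KL transpose_diff symK)
  then show ?thesis using that LX unfolding L_def K_def by blast
qed

text \<open>The distance is a square root, which Isabelle extends to negative arguments; here the radicand
  is the squared length of \<open>X (e\<^sub>i - e\<^sub>j)\<close>.\<close>

lemma biharmonic_index_eq_trace:
  fixes G :: "'v::finite pair_pre_digraph"
  assumes sym: "sym (parcs G)" and V: "pverts G = UNIV"
    and X: "is_moore_penrose_inverse (laplacian_matrix G) X"
  shows "biharmonic_index G = real CARD('v) * trace (X ** X)"
proof -
  define Q where "Q = X ** X"
  note symX = symmetric_moore_penrose_inverse[OF X transpose_laplacian[OF sym]]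
  have Q: "laplacian_pinv_squared G = Q"
    by (simp add: laplacian_pinv_squared_def moore_penrose_inverse_eqI[OF X] Q_def)
  \<comment> \<open>By symmetry of \<open>X\<close>, \<open>Q\<close> is the Gram matrix of the
    columns of \<open>X\<close>.\<close>
  have Qij: "Q $ i $ j = column i X \<bullet> column j X" for i j
    unfolding Q_def by (subst symX(1)[symmetric], simp add: matrix_mult_transpose_dot_column)
  have "(biharmonic_distance G i j)\<^sup>2 = Q $ i $ i + Q $ j $ j - 2 * Q $ i $ j" for i j
  proof -
    have "Q $ i $ i + Q $ j $ j - 2 * Q $ i $ j =
        (column i X - column j X) \<bullet> (column i X - column j X)"
      by (simp add: Qij inner_diff_left inner_diff_right inner_commute)
    then show ?thesis by (simp add: biharmonic_distance_def Q)
  qed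
  then have "biharmonic_index G =
      1 / 2 * (2 * real CARD('v) * trace Q - 2 * (\<Sum>i\<in>UNIV. \<Sum>j\<in>UNIV. Q $ i $ j))"
    by (simp add: biharmonic_index_def V sum.distrib sum_subtractf sum_distrib_left trace_def mult_ac)
  moreover have "(\<Sum>i\<in>UNIV. \<Sum>j\<in>UNIV. Q $ i $ j) = 1 \<bullet> (Q *v 1)"
    by (simp add: inner_vec_def matrix_vector_mult_def)
  \<comment> \<open>\<open>X = X ** X ** L\<close> for the Laplacian \<open>L\<close>, because the
    two commute, and \<open>L\<close> annihilates 1. Hence the entries of \<open>Q\<close> sum to 0
    and only the trace term survives.\<close>
  moreover have "X *v 1 = 0"
    by (metis X is_moore_penrose_inverse_def laplacian_mult_one matrix_mul_assoc
        matrix_vector_mul_assoc matrix_vector_mult_0_right symX(2))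
  then have "Q *v 1 = 0" by (simp add: Q_def flip: matrix_vector_mul_assoc)
  ultimately show ?thesis by (simp add: Q_def)
qed

section \<open>Adding an edge\<close>

lemma laplacian_add_edge:
  fixes G :: "'v::finite pair_pre_digraph"
  assumes "u \<noteq> v" "(u, v) \<notin> parcs G" "(v, u) \<notin> parcs G"
  shows "laplacian_matrix (add_edge G u v) =
    laplacian_matrix G + outer_product (axis u 1 - axis v 1) (axis u 1 - axis v 1)"
proof -
  let ?w = "axis u 1 - axis v 1 :: real ^ 'v"
  have axis_component: "axis a 1 $ i = (if i = a then 1 else (0::real))" for a i :: 'v
    by (simp add: axis_def)
  have "(laplacian_matrix (add_edge G u v) *v x) $ i =
      ((laplacian_matrix G + outer_product ?w ?w) *v x) $ i" for x i
  proof -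
    \<comment> \<open>The two extra summands are the new arcs \<open>(u, v)\<close> and
      \<open>(v, u)\<close>; as neither was present before, no arc is counted twice.\<close>
    have "(laplacian_matrix (add_edge G u v) *v x) $ i = (\<Sum>j\<in>UNIV.
        (if (i, j) \<in> parcs G then x $ i - x $ j else 0)
        + (if j = v then if i = u then x $ u - x $ v else 0 else 0)
        + (if j = u then if i = v then x $ v - x $ u else 0 else 0))"
      unfolding laplacian_mult_vector
      by (rule sum.cong) (use assms in \<open>auto simp: add_edge_def\<close>)
    also have "\<dots> = (laplacian_matrix G *v x) $ i
        + (if i = u then x $ u - x $ v else 0) + (if i = v then x $ v - x $ u else 0)"
      by (simp add: sum.distrib laplacian_mult_vector)
    also have "\<dots> = ((laplacian_matrix G + outer_product ?w ?w) *v x) $ i"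
      using assms(1)
      by (auto simp: matrix_vector_mult_add_rdistrib outer_product_mult_vector inner_diff_left inner_axis'
          axis_component)
    finally show ?thesis .
  qed
  then show ?thesis by (simp add: matrix_eq vec_eq_iff)
qed

theorem theorem4p5:
  fixes G :: "'v::finite pair_pre_digraph" and u v :: 'v
  assumes "pair_graph G"
    and "pverts G = UNIV"
    and "Digraph_Component.connected (with_proj G)"
    and "u \<noteq> v"
    and "(u, v) \<notin> parcs G"
  shows "biharmonic_index (add_edge G u v) < biharmonic_index G"
proof -
  interpret pair_graph G by fact
  have sym: "sym (parcs G)" by (auto intro!: symI arcs_symmetric)
  then have sym': "sym (parcs (add_edge G u v))" by (auto simp: sym_def add_edge_def)
  have V': "pverts (add_edge G u v) = UNIV" using assms(2) by (simp add: add_edge_def)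
  let ?w = "axis u 1 - axis v 1 :: real ^ 'v"
  obtain X where X: "is_moore_penrose_inverse (laplacian_matrix G) X"
    and LX: "laplacian_matrix G ** X = mat 1 - (1 / real CARD('v)) *\<^sub>R outer_product 1 1"
    using laplacian_moore_penrose_inverse_exists[OF sym assms(2,3)] .
  note psd = positive_semidefinite_laplacian[OF sym]
  \<comment> \<open>The entries of \<open>?w\<close> sum to 0, so the projection
    \<open>mat 1 - J / n\<close> given by \<open>LX\<close>, with \<open>J\<close> the all-ones
    matrix, fixes it. This puts \<open>?w\<close> in the range of the Laplacian.\<close>
  have "1 \<bullet> ?w = 0" by (simp add: inner_diff_right inner_axis)
  then have w: "laplacian_matrix G *v (X *v ?w) = ?w"
    by (simp add: matrix_vector_mul_assoc LX matrix_vector_mult_diff_rdistrib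
        outer_product_simps)
  have "?w \<noteq> 0" using assms(4) by (simp add: axis_eq_axis)
  have L': "laplacian_matrix (add_edge G u v) = laplacian_matrix G + outer_product ?w ?w"
    using laplacian_add_edge assms(4,5) arcs_symmetric by blast
  obtain X' where X': "is_moore_penrose_inverse (laplacian_matrix G + outer_product ?w ?w) X'"
    using is_moore_penrose_inverse_rank_one_update[OF X psd w] by blast
  show ?thesis
    using trace_square_moore_penrose_inverse_rank_one_update[OF X psd w \<open>?w \<noteq> 0\<close> X']
      biharmonic_index_eq_trace[OF sym assms(2) X]
      biharmonic_index_eq_trace[OF sym' V', of X'] X' L'
    by simp
qed

end
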